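(* Let $\mathsf P\subseteq\mathbb R^d$ be a polytope, and let $\pi:\mathbb R^d\to\mathbb R^e$ be an affine map that is injective on every $2$-face of $\mathsf P$. Then $\mathbb{DC}(\mathsf P)=\mathbb{DC}(\pi(\mathcal F(\mathsf P)))$ (and hence also the graphs of edge dependencies of $\mathsf P$ and of $\pi(\mathcal F(\mathsf P))$ coincide).
   Context: A framework in $\mathbb R^d$ is a triple $\mathcal F=(V,E,\phi)$ with $V$ a finite set (vertices), $E\subseteq\binom{V}{2}$ (edges), and $\phi:V\to\mathbb R^d$. An edge $uv$ is degenerate if $\phi_u=\phi_v$, non-degenerate otherwise. A framework $\mathcal G=(V,E,\psi)$ in the same $\mathbb R^d$ on the same graph is a deformation of $\mathcal F$ if for every $uv\in E$ there is $\lambda_{uv}\ge 0$ with $\psi_v-\psi_u=\lambda_{uv}(\phi_v-\phi_u)$. Its edge-deformation vector in $\mathbb R_{\ge 0}^E$ has coordinate $\lambda_{uv}$ for non-degenerate $uv$ and $0$ for degenerate $uv$. The deformation cone $\mathbb{DC}(\mathcal F)\subset\mathbb R^E$ is the set of edge-deformation vectors of all deformations of $\mathcal F$. The graph of edge dependencies of $\mathcal F$ has as nodes the non-degenerate edges of $\mathcal F$, with an arc between $e$ and $f$ if $\lambda_e=\lambda_f$ for all $\lambda\in\mathbb{DC}(\mathcal F)$ (so there is a loop at every node). For a polytope $\mathsf P\subset\mathbb R^d$, $\mathcal F(\mathsf P)=(V(\mathsf P),E(\mathsf P),\mathrm{id})$ is the framework given by its vertices and edges (each edge identified with its pair of endpoints),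 $\mathbb{DC}(\mathsf P):=\mathbb{DC}(\mathcal F(\mathsf P))$, and the graph of edge dependencies of $\mathsf P$ is that of $\mathcal F(\mathsf P)$. For an affine map $\pi$ and a framework $\mathcal F=(V,E,\phi)$, $\pi(\mathcal F)=(V,E,\pi\circ\phi)$.
   Formalization: If P is a segment it has no 2-face and π may collapse it to a point, giving cones R≥0 and {0}; the formal statement therefore also assumes π injective on P when dim P = 1 (and takes d, e ≥ 1, which excludes only edgeless cases). *)

theory Defs
  imports "HOL-Analysis.Analysis"
begin

record ('v, 'a) framework =
  fverts :: "'v set"
  fedges :: "'v set set"
  fpos :: "'v \<Rightarrow> 'a"

definition is_framework :: "('v, 'a) framework \<Rightarrow> bool" where
  "is_framework F \<longleftrightarrow>
     finite (fverts F) \<and> fedges F \<subseteq> {e. e \<subseteq> fverts F \<and> card e = 2}"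

definition degenerate :: "('v, 'a) framework \<Rightarrow> 'v set \<Rightarrow> bool" where
  "degenerate F e \<longleftrightarrow> (\<exists>u v. e = {u, v} \<and> fpos F u = fpos F v)"

definition deformation ::
    "('v, 'a::real_vector) framework \<Rightarrow> ('v, 'a) framework \<Rightarrow> bool" where
  "deformation F G \<longleftrightarrow>
     is_framework G \<and> fverts G = fverts F \<and> fedges G = fedges F \<and>
     (\<forall>u v. {u, v} \<in> fedges F \<longrightarrow>
        (\<exists>c\<ge>0. fpos G v - fpos G u = c *\<^sub>R (fpos F v - fpos F u)))"

text \<open>Vectors indexed by the edge set are functions restricted to it
  (with value \<^term>\<open>undefined\<close> elsewhere), so equality of such functions is
  equality of all coordinates. The description operator is only meaningful if
  \<^term>\<open>G\<close> is a deformation of \<^term>\<open>F\<close>; the factor is then unique, see the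
  lemma below.\<close>

definition edge_deformation_vector ::
    "('v, 'a::real_vector) framework \<Rightarrow> ('v, 'a) framework \<Rightarrow> 'v set \<Rightarrow> real" where
  "edge_deformation_vector F G =
     (\<lambda>e\<in>fedges F. if degenerate F e then 0
        else (THE c. \<forall>u v. e = {u, v} \<longrightarrow>
                fpos G v - fpos G u = c *\<^sub>R (fpos F v - fpos F u)))"

lemma edge_deformation_vector_eqI:
  fixes F G :: "('v, 'a::real_vector) framework"
  assumes e: "{u, v} \<in> fedges F" and ne: "fpos F u \<noteq> fpos F v"
    and c: "fpos G v - fpos G u = c *\<^sub>R (fpos F v - fpos F u)"
  shows "edge_deformation_vector F G {u, v} = c"
proof -
  have c': "fpos G u - fpos G v = c *\<^sub>R (fpos F u - fpos F v)"
    using arg_cong[OF c, of uminus] by (simp flip: scaleR_minus_right)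
  have "(THE k. \<forall>a b. {u, v} = {a, b} \<longrightarrow>
          fpos G b - fpos G a = k *\<^sub>R (fpos F b - fpos F a)) = c"
  proof (rule the_equality)
    show "\<forall>a b. {u, v} = {a, b} \<longrightarrow> fpos G b - fpos G a = c *\<^sub>R (fpos F b - fpos F a)"
      using c c' by (auto simp: doubleton_eq_iff)
  next
    fix k
    assume "\<forall>a b. {u, v} = {a, b} \<longrightarrow> fpos G b - fpos G a = k *\<^sub>R (fpos F b - fpos F a)"
    then have "k *\<^sub>R (fpos F v - fpos F u) = c *\<^sub>R (fpos F v - fpos F u)"
      using c by metis
    then show "k = c" using ne by simp
  qed
  moreover have "\<not> degenerate F {u, v}"
    using ne by (auto simp: degenerate_def doubleton_eq_iff)
  ultimately show ?thesis
    using e by (simp add: edge_deformation_vector_def)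
qed

definition deformation_cone ::
    "('v, 'a::real_vector) framework \<Rightarrow> ('v set \<Rightarrow> real) set" where
  "deformation_cone F = {edge_deformation_vector F G | G. deformation F G}"

text \<open>A graph as a pair of its node set and its (symmetric) arc relation.\<close>

definition edge_dependency_graph ::
    "('v, 'a::real_vector) framework \<Rightarrow> 'v set set \<times> ('v set \<times> 'v set) set" where
  "edge_dependency_graph F =
     (let N = {e \<in> fedges F. \<not> degenerate F e}
      in (N, {(e, f). e \<in> N \<and> f \<in> N \<and> (\<forall>l \<in> deformation_cone F. l e = l f)}))"

definition polytope_framework :: "'a::euclidean_space set \<Rightarrow> ('a, 'a) framework" where
  "polytope_framework P =
     \<lparr>fverts = {x. x extreme_point_of P},
      fedges = {{u, v} | u v. closed_segment u v edge_of P},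
      fpos = id\<rparr>"

lemma is_framework_polytope_framework:
  fixes P :: "'a::euclidean_space set"
  assumes "polytope P"
  shows "is_framework (polytope_framework P)"
proof -
  have "finite {x. x extreme_point_of P}"
    using assms by (simp add: finite_polyhedron_extreme_points polytope_imp_polyhedron)
  moreover have "{u, v} \<subseteq> {x. x extreme_point_of P} \<and> card {u, v} = 2"
    if "closed_segment u v edge_of P" for u v
  proof -
    from that have f: "closed_segment u v face_of P" and d: "aff_dim (closed_segment u v) = 1"
      by (auto simp: edge_of_def)
    have "u \<noteq> v" using d by auto
    moreover have "u extreme_point_of P" "v extreme_point_of P"
      using extreme_point_of_face[OF f] by (auto simp: extreme_point_of_segment)
    ultimately show ?thesis by auto
  qed
  ultimately show ?thesis
    by (auto simp: is_framework_def polytope_framework_def)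
qed

definition map_framework ::
    "('a \<Rightarrow> 'b) \<Rightarrow> ('v, 'a) framework \<Rightarrow> ('v, 'b) framework" where
  "map_framework h F = \<lparr>fverts = fverts F, fedges = fedges F, fpos = h \<circ> fpos F\<rparr>"

definition affine_map :: "('a::real_vector \<Rightarrow> 'b::real_vector) \<Rightarrow> bool" where
  "affine_map h \<longleftrightarrow> (\<exists>L c. linear L \<and> h = (\<lambda>x. L x + c))"

end

theory Submission
  imports Defs
begin

text \<open>
  Composing a deformation of \<open>P\<close> with the linear part of \<open>h\<close> keeps all edge factors, which gives one
  inclusion. Conversely, given edge factors \<open>l\<close> of a deformation of the image, we need positions \<open>f\<close>
  with \<open>f v - f u = l {u, v} (v - u)\<close> along every edge. On a 2-face such positions are obtained by
  applying a left inverse of the linear part of \<open>h\<close>. To glue them, choose a linear functional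
  \<open>c\<close> that separates the vertices and define \<open>f\<close> on one vertex after the other, in decreasing order
  of \<open>c\<close>. At a new vertex \<open>v\<close> every upward edge prescribes a value. Two upward edges in a common
  2-face prescribe the same one, because the part of the 2-face above \<open>v\<close> is connected; and any two
  upward edges are linked through such 2-faces, because the part of the vertex figure of \<open>v\<close> where
  \<open>c\<close> exceeds \<open>c v\<close> is connected.
\<close>

section \<open>Faces of polytopes and of their hyperplane sections\<close>

lemma polytope_Int_hyperplane:
  fixes P :: "'a::euclidean_space set"
  assumes "polytope P"
  shows "polytope (P \<inter> {x. a \<bullet> x = b})"
  using assms by (simp add: polytope_Int_polyhedron polyhedron_hyperplane)

lemma polytope_extreme_point_ge:
  fixes P :: "'a::euclidean_space set"
  assumes "polytope P" "x \<in> P"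
  obtains u where "u extreme_point_of P" "c \<bullet> x \<le> c \<bullet> u"
proof -
  have "x \<in> convex hull {u. u extreme_point_of P}"
    using assms Krein_Milman_Minkowski polytope_imp_compact polytope_imp_convex by blast
  moreover have "convex hull {u. u extreme_point_of P} \<subseteq> {y. c \<bullet> y < c \<bullet> x}"
    if "\<And>u. u extreme_point_of P \<Longrightarrow> c \<bullet> u < c \<bullet> x"
    using that by (intro hull_minimal) (auto simp: convex_halfspace_lt)
  ultimately show thesis using that by (force simp: not_le)
qed

text \<open>The intersection of all faces through \<open>x\<close> works: if \<open>x\<close> were
  on its relative frontier, a proper face of it would be a smaller face of \<open>P\<close> through
  \<open>x\<close>.\<close>

lemma polytope_minimal_face:
  fixes P :: "'a::euclidean_space set"
  assumes "polytope P" "x \<in> P"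
  obtains F where "F face_of P" "x \<in> rel_interior F"
proof -
  define F where "F = \<Inter>{F. F face_of P \<and> x \<in> F}"
  have ne: "P \<in> {F. F face_of P \<and> x \<in> F}"
    using assms by (simp add: face_of_refl polytope_imp_convex)
  have F: "F face_of P" unfolding F_def using ne by (intro face_of_Inter) auto
  have "x \<in> F" by (simp add: F_def)
  have "polytope F" using assms(1) F face_of_polytope_polytope by blast
  have "x \<notin> rel_frontier F"
  proof
    assume "x \<in> rel_frontier F"
    then obtain G where "G face_of F" "G \<noteq> F" "x \<in> G"
      using rel_frontier_of_polyhedron_alt[OF polytope_imp_polyhedron[OF \<open>polytope F\<close>]] by auto
    moreover have "G face_of P" using \<open>G face_of F\<close> F face_of_trans by blast
    ultimately have "F \<subseteq> G" unfolding F_def by blast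
    then show False using \<open>G face_of F\<close> \<open>G \<noteq> F\<close> face_of_imp_subset by blast
  qed
  then have "x \<in> rel_interior F"
    using \<open>x \<in> F\<close> closure_subset by (auto simp: rel_frontier_def)
  then show thesis using that F by blast
qed

text \<open>\<open>F\<close> is the face of \<open>P\<close> that has a relative interior point of
  \<open>G\<close> in its own relative interior. As no vertex lies on the hyperplane, slicing
  \<open>F\<close> lowers the dimension by exactly one.\<close>

lemma face_of_hyperplane_section:
  fixes P :: "'a::euclidean_space set"
  assumes P: "polytope P" and G: "G face_of P \<inter> {x. a \<bullet> x = b}" "G \<noteq> {}"
    and no_vertex: "\<And>v. v extreme_point_of P \<Longrightarrow> a \<bullet> v \<noteq> b"
  obtains F where "F face_of P" "G = F \<inter> {x. a \<bullet> x = b}" "aff_dim F = aff_dim G + 1"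
proof -
  let ?H = "{x. a \<bullet> x = b}"
  have "convex G" using G face_of_imp_convex by blast
  then obtain g where g: "g \<in> rel_interior G" using G rel_interior_eq_empty by blast
  have "g \<in> G" using g rel_interior_subset by blast
  then have gP: "g \<in> P" "g \<in> ?H" using G face_of_imp_subset by blast+
  obtain F where F: "F face_of P" and gF: "g \<in> rel_interior F"
    using polytope_minimal_face[OF P gP(1)] .
  have cF: "convex F" using F face_of_imp_convex by blast
  \<comment> \<open>\<open>G\<close> and the slice of \<open>F\<close> are faces of the same section
    with the common relative interior point \<open>g\<close>, so each contains the other.\<close>
  have FH: "F \<inter> ?H face_of P \<inter> ?H"
    using F by (intro face_of_slice) (simp_all add: convex_hyperplane)
  have "g \<in> F \<inter> ?H" using gP gF rel_interior_subset by blast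
  then have sub1: "G \<subseteq> F \<inter> ?H"
    using subset_of_face_of[OF FH face_of_imp_subset[OF G(1)]] g by blast
  have "rel_interior (F \<inter> ?H) = rel_interior F \<inter> ?H"
    using gF gP cF by (intro convex_affine_rel_interior_Int) (auto simp: affine_hyperplane)
  then have "g \<in> rel_interior (F \<inter> ?H)" using gF gP by blast
  then have "F \<inter> ?H \<subseteq> G"
    using subset_of_face_of[OF G(1) face_of_imp_subset[OF FH]] \<open>g \<in> G\<close> by blast
  with sub1 have GF: "G = F \<inter> ?H" by blast
  \<comment> \<open>Near \<open>g\<close> the flat \<open>?A\<close> lies inside \<open>G\<close>,
    so both have the same dimension.\<close>
  obtain T where T: "open T" "g \<in> T" "T \<inter> affine hull F \<subseteq> F"
    using gF by (auto simp: mem_rel_interior)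
  let ?A = "affine hull F \<inter> ?H"
  have gA: "g \<in> ?A" using gP \<open>g \<in> F \<inter> ?H\<close> hull_inc by fastforce
  have "affine ?A" by (simp add: affine_Int affine_hyperplane)
  then have "affine hull (?A \<inter> T) = ?A"
    using affine_hull_affine_Int_open[of ?A T] T gA by (metis IntI empty_iff hull_same)
  moreover have "?A \<inter> T \<subseteq> G" using T GF by blast
  moreover have "G \<subseteq> ?A" using GF hull_subset[of F affine] by blast
  ultimately have "aff_dim ?A = aff_dim G"
    using aff_dim_subset[of "?A \<inter> T" G] aff_dim_subset[of G ?A] aff_dim_affine_hull[of "?A \<inter> T"]
    by simp
  moreover obtain v where "v extreme_point_of F"
    using polytope_extreme_point_ge[OF face_of_polytope_polytope[OF P F]] \<open>g \<in> F \<inter> ?H\<close> by blast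
  then have "v \<in> F" "a \<bullet> v \<noteq> b"
    using no_vertex F extreme_point_of_face by blast+
  then have "\<not> affine hull F \<subseteq> ?H" by (auto intro: hull_inc dest!: subsetD)
  then have "aff_dim ?A = aff_dim F - 1"
    using gA aff_dim_affine_Int_hyperplane[of "affine hull F" a b] by auto
  ultimately show thesis using that F GF by simp
qed

section \<open>Vertex figures\<close>

text \<open>Deleting an extreme point leaves a convex set, so the hull of the other vertices misses
  \<open>v\<close> and, being compact, can be strictly separated from it.\<close>

lemma polytope_vertex_separation:
  fixes P :: "'a::euclidean_space set"
  assumes P: "polytope P" and v: "v extreme_point_of P"
  obtains a b where "a \<bullet> v < b" "\<And>u. u extreme_point_of P \<Longrightarrow> u \<noteq> v \<Longrightarrow> b < a \<bullet> u"
proof -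
  let ?W = "{u. u extreme_point_of P} - {v}"
  have "finite ?W" using P by (simp add: finite_polyhedron_extreme_points polytope_imp_polyhedron)
  have "convex (P - {v})" using v P by (simp add: extreme_point_of_stillconvex polytope_imp_convex)
  then have "convex hull ?W \<subseteq> P - {v}"
    by (intro hull_minimal) (auto simp: extreme_point_of_def)
  then obtain a b where "a \<bullet> v < b" "\<forall>x \<in> convex hull ?W. a \<bullet> x > b"
    using separating_hyperplane_closed_point[of "convex hull ?W" v] \<open>finite ?W\<close>
    by (auto simp: finite_imp_compact_convex_hull compact_imp_closed)
  moreover have "?W \<subseteq> convex hull ?W" by (rule hull_subset)
  ultimately show thesis by (intro that[of a b]) auto
qed

lemma edge_of_endpoints:
  fixes P :: "'a::euclidean_space set"
  assumes "closed_segment u v edge_of P"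
  shows "u extreme_point_of P" "v extreme_point_of P" "u \<noteq> v" "u \<in> P" "v \<in> P"
proof -
  have f: "closed_segment u v face_of P" and d: "aff_dim (closed_segment u v) = 1"
    using assms by (auto simp: edge_of_def)
  show "u \<noteq> v" using d by auto
  show "u extreme_point_of P" "v extreme_point_of P"
    using extreme_point_of_face[OF f] by (auto simp: extreme_point_of_segment)
  then show "u \<in> P" "v \<in> P" by (auto simp: extreme_point_of_def)
qed

lemma edge_of_closed_segment:
  fixes P :: "'a::euclidean_space set"
  assumes "polytope P" "E edge_of P"
  obtains u v where "E = closed_segment u v"
proof -
  have "E face_of P" "aff_dim E = 1" using assms by (auto simp: edge_of_def)
  then have "polytope E" "collinear E" "E \<noteq> {}"
    using assms(1) face_of_polytope_polytope by (auto simp: collinear_aff_dim)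
  then show thesis
    by (auto intro: that compact_convex_collinear_segment[of E]
        simp: polytope_imp_compact polytope_imp_convex)
qed

text \<open>A vertex of the section comes from a one-dimensional face of \<open>P\<close>. This edge
  meets the hyperplane, so its ends cannot both lie beyond it, and \<open>v\<close> is the only
  vertex on the near side.\<close>

lemma vertex_figure_vertex:
  fixes P :: "'a::euclidean_space set"
  assumes P: "polytope P" and v: "a \<bullet> v < b"
    and sep: "\<And>u. u extreme_point_of P \<Longrightarrow> u \<noteq> v \<Longrightarrow> b < a \<bullet> u"
    and q: "q extreme_point_of P \<inter> {x. a \<bullet> x = b}"
  obtains u where "closed_segment v u edge_of P" "q \<in> open_segment v u"
proof -
  have nv: "a \<bullet> u \<noteq> b" if "u extreme_point_of P" for u
    using sep[OF that] v by (cases "u = v") auto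
  obtain F where F: "F face_of P" "{q} = F \<inter> {x. a \<bullet> x = b}" "aff_dim F = aff_dim {q} + 1"
    using face_of_hyperplane_section[OF P _ _ nv, of "{q}"] q by (auto simp: face_of_singleton)
  then have E: "F edge_of P" unfolding edge_of_def by (metis aff_dim_sing add_0)
  obtain x y where xy: "F = closed_segment x y" using edge_of_closed_segment[OF P E] .
  note ends = edge_of_endpoints[OF E[unfolded xy]]
  have qF: "q \<in> closed_segment x y" "a \<bullet> q = b" using F xy by auto
  then have "q \<noteq> x" "q \<noteq> y" using nv ends by auto
  then have qo: "q \<in> open_segment x y" using qF by (simp add: open_segment_def)
  have "x = v \<or> y = v"
  proof (rule ccontr)
    assume "\<not> ?thesis"
    then have "b < a \<bullet> x" "b < a \<bullet> y" using sep ends by auto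
    then have "closed_segment x y \<subseteq> {z. b < a \<bullet> z}"
      by (intro closed_segment_subset) (auto simp: convex_halfspace_gt)
    then show False using qF by auto
  qed
  then show thesis
    using that[of x] that[of y] E xy qo
    by (auto simp: closed_segment_commute open_segment_commute)
qed

text \<open>Counterpart of \<open>vertex_figure_vertex\<close>: the hyperplane meets the edge in a
  single point, and slices of faces are faces of the section.\<close>

lemma edge_of_Int_hyperplane:
  fixes P :: "'a::euclidean_space set"
  assumes "closed_segment v u edge_of P" "a \<bullet> v < b" "b < a \<bullet> u"
  obtains q where "q \<in> open_segment v u" "q extreme_point_of P \<inter> {x. a \<bullet> x = b}"
proof -
  define t where "t = (b - a \<bullet> v) / (a \<bullet> u - a \<bullet> v)"
  have t: "0 < t" "t < 1" using assms by (auto simp: t_def divide_simps)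
  define q where "q = (1 - t) *\<^sub>R v + t *\<^sub>R u"
  have line: "a \<bullet> ((1 - s) *\<^sub>R v + s *\<^sub>R u) = a \<bullet> v + s * (a \<bullet> u - a \<bullet> v)" for s
    by (simp add: inner_simps algebra_simps)
  have ne: "a \<bullet> u - a \<bullet> v \<noteq> 0" using assms by simp
  then have q: "a \<bullet> q = b" unfolding q_def line by (simp add: t_def)
  have qo: "q \<in> open_segment v u"
    using t edge_of_endpoints(3)[OF assms(1)] unfolding q_def in_segment by blast
  have "closed_segment v u \<inter> {x. a \<bullet> x = b} = {q}"
  proof -
    have "x = q" if x: "x \<in> closed_segment v u" "a \<bullet> x = b" for x
    proof -
      obtain s where s: "x = (1 - s) *\<^sub>R v + s *\<^sub>R u" using x by (auto simp: in_segment)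
      then have "a \<bullet> v + s * (a \<bullet> u - a \<bullet> v) = a \<bullet> v + t * (a \<bullet> u - a \<bullet> v)"
        using x q line q_def by simp
      then have "s = t" using ne by simp
      then show ?thesis by (simp add: s q_def)
    qed
    then show ?thesis using q qo by (auto simp: open_segment_def)
  qed
  moreover have "closed_segment v u \<inter> {x. a \<bullet> x = b} face_of P \<inter> {x. a \<bullet> x = b}"
    using assms(1) by (intro face_of_slice) (auto simp: edge_of_def convex_hyperplane)
  ultimately have "q extreme_point_of P \<inter> {x. a \<bullet> x = b}" by (simp add: face_of_singleton)
  then show thesis using that qo by blast
qed

text \<open>Lets the direction of an edge at \<open>v\<close> be tested at its crossing point with
  the vertex figure.\<close>

lemma inner_open_segment_gt_iff:
  assumes "q \<in> open_segment v u"
  shows "c \<bullet> v < c \<bullet> q \<longleftrightarrow> c \<bullet> v < c \<bullet> u"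
proof -
  obtain t where "0 < t" "q = (1 - t) *\<^sub>R v + t *\<^sub>R u" using assms by (auto simp: in_segment)
  then have "c \<bullet> q - c \<bullet> v = t * (c \<bullet> u - c \<bullet> v)" by (simp add: inner_simps) (simp add: algebra_simps)
  then have "0 < c \<bullet> q - c \<bullet> v \<longleftrightarrow> 0 < c \<bullet> u - c \<bullet> v"
    using \<open>0 < t\<close> by (simp only: zero_less_mult_iff) auto
  then show ?thesis by simp
qed

section \<open>Monotone edge paths and connectivity above a level\<close>

text \<open>The segment from \<open>v\<close> to a higher vertex crosses the vertex figure above the
  level of \<open>v\<close>; a vertex of the figure that is at least as high lies on an ascending
  edge. This is the improvement step of the simplex method.\<close>

lemma polytope_improving_edge:
  fixes P :: "'a::euclidean_space set"
  assumes P: "polytope P" and v: "v extreme_point_of P" and x: "x \<in> P" "c \<bullet> v < c \<bullet> x"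
  obtains u where "closed_segment v u edge_of P" "c \<bullet> v < c \<bullet> u"
proof -
  obtain a b where av: "a \<bullet> v < b" and sep: "\<And>u. u extreme_point_of P \<Longrightarrow> u \<noteq> v \<Longrightarrow> b < a \<bullet> u"
    by (rule polytope_vertex_separation[OF P v]) auto
  let ?Q = "P \<inter> {x. a \<bullet> x = b}"
  obtain y where y: "y extreme_point_of P" "c \<bullet> x \<le> c \<bullet> y"
    using polytope_extreme_point_ge[OF P x(1)] .
  then have "y \<noteq> v" using x by auto
  then have ay: "b < a \<bullet> y" using sep y by blast
  \<comment> \<open>\<open>y\<close> need not be adjacent to \<open>v\<close>; \<open>t\<close>
    locates the point \<open>q\<close> where the segment to \<open>y\<close> meets the cutting
    hyperplane.\<close>
  define t where "t = (b - a \<bullet> v) / (a \<bullet> y - a \<bullet> v)"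
  have t: "0 < t" "t < 1" using av ay by (auto simp: t_def divide_simps)
  define q where "q = (1 - t) *\<^sub>R v + t *\<^sub>R y"
  have "a \<bullet> q = a \<bullet> v + t * (a \<bullet> y - a \<bullet> v)" by (simp add: q_def algebra_simps inner_simps)
  then have "a \<bullet> q = b" using av ay by (simp add: t_def)
  moreover have qo: "q \<in> open_segment v y" using t \<open>y \<noteq> v\<close> unfolding q_def in_segment by blast
  moreover have "q \<in> P"
    using qo v y P closed_segment_subset[of v P y]
    by (auto simp: extreme_point_of_def polytope_imp_convex open_segment_def)
  ultimately have "q \<in> ?Q" by simp
  then obtain r where r: "r extreme_point_of ?Q" "c \<bullet> q \<le> c \<bullet> r"
    by (rule polytope_extreme_point_ge[OF polytope_Int_hyperplane[OF P]])
  have "c \<bullet> v < c \<bullet> r" using r qo inner_open_segment_gt_iff[OF qo, of c] x y by auto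
  moreover obtain u where "closed_segment v u edge_of P" "r \<in> open_segment v u"
    using vertex_figure_vertex[OF P av sep r(1)] .
  ultimately show thesis using inner_open_segment_gt_iff[of r v u c] that by simp
qed

text \<open>The reflexive transitive closure of this relation expresses paths in the edge graph that
  stay in an open half-space.\<close>

definition edges_above :: "'a::euclidean_space set \<Rightarrow> 'a \<Rightarrow> real \<Rightarrow> ('a \<times> 'a) set" where
  "edges_above P c s = {(u, v). closed_segment u v edge_of P \<and> s < c \<bullet> u \<and> s < c \<bullet> v}"

lemma sym_edges_above: "sym (edges_above P c s)"
  by (auto simp: sym_def edges_above_def closed_segment_commute)

text \<open>Ascent along improving edges: the number of vertices strictly above the current one
  drops at every step, and the path never falls to level \<open>s\<close>.\<close>

lemma polytope_path_to_maximum: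
  fixes P :: "'a::euclidean_space set"
  assumes P: "polytope P" and "v extreme_point_of P" "s < c \<bullet> v"
  shows "\<exists>u. u extreme_point_of P \<and> (\<forall>x\<in>P. c \<bullet> x \<le> c \<bullet> u) \<and> (v, u) \<in> (edges_above P c s)\<^sup>*"
  using assms(2,3)
proof (induction "card {w. w extreme_point_of P \<and> c \<bullet> v < c \<bullet> w}" arbitrary: v rule: less_induct)
  case less
  show ?case
  proof (cases "\<forall>x\<in>P. c \<bullet> x \<le> c \<bullet> v")
    case True
    then show ?thesis using less.prems by blast
  next
    case False
    then obtain x where "x \<in> P" "c \<bullet> v < c \<bullet> x" by force
    then obtain u where u: "closed_segment v u edge_of P" "c \<bullet> v < c \<bullet> u"
      using polytope_improving_edge[OF P less.prems(1)] by blast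
    have ue: "u extreme_point_of P" using edge_of_endpoints u by blast
    have "finite {w. w extreme_point_of P}"
      using P by (simp add: finite_polyhedron_extreme_points polytope_imp_polyhedron)
    moreover have "{w. w extreme_point_of P \<and> c \<bullet> u < c \<bullet> w} \<subset> {w. w extreme_point_of P \<and> c \<bullet> v < c \<bullet> w}"
      using u ue by auto
    ultimately have "card {w. w extreme_point_of P \<and> c \<bullet> u < c \<bullet> w}
        < card {w. w extreme_point_of P \<and> c \<bullet> v < c \<bullet> w}"
      by (intro psubset_card_mono) auto
    moreover have "s < c \<bullet> u" using u less.prems by simp
    ultimately obtain z where "z extreme_point_of P" "\<forall>x\<in>P. c \<bullet> x \<le> c \<bullet> z"
        "(u, z) \<in> (edges_above P c s)\<^sup>*"
      using less.hyps ue by blast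
    moreover have "(v, u) \<in> edges_above P c s"
      using u less.prems by (auto simp: edges_above_def)
    ultimately show ?thesis by (meson converse_rtrancl_into_rtrancl)
  qed
qed

text \<open>Paths from \<open>u\<close> and \<open>v\<close> first climb to the face \<open>M\<close> where \<open>c\<close> is maximal; inside \<open>M\<close> a
  second functional, maximal at a single vertex, joins their ends.\<close>

lemma edges_above_connected:
  fixes P :: "'a::euclidean_space set"
  assumes P: "polytope P"
    and u: "u extreme_point_of P" "s < c \<bullet> u" and v: "v extreme_point_of P" "s < c \<bullet> v"
  shows "(u, v) \<in> (edges_above P c s)\<^sup>*"
proof -
  let ?R = "(edges_above P c s)\<^sup>*"
  obtain u' where u': "u' extreme_point_of P" "\<forall>x\<in>P. c \<bullet> x \<le> c \<bullet> u'" "(u, u') \<in> ?R"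
    using polytope_path_to_maximum[OF P u] by blast
  obtain v' where v': "v' extreme_point_of P" "\<forall>x\<in>P. c \<bullet> x \<le> c \<bullet> v'" "(v, v') \<in> ?R"
    using polytope_path_to_maximum[OF P v] by blast
  define M where "M = P \<inter> {x. c \<bullet> x = c \<bullet> u'}"
  have M: "M face_of P" unfolding M_def
    using u' P by (intro face_of_Int_supporting_hyperplane_le) (auto simp: polytope_imp_convex)
  then have pM: "polytope M" using P face_of_polytope_polytope by blast
  have uvP: "u \<in> P" "u' \<in> P" "v' \<in> P" using u u' v' by (auto simp: extreme_point_of_def)
  then have "c \<bullet> v' = c \<bullet> u'" using u' v' by (auto intro: antisym)
  then have ext: "u' extreme_point_of M" "v' extreme_point_of M"
    using extreme_point_of_face[OF M] u' v' uvP by (auto simp: M_def)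
  \<comment> \<open>\<open>v'\<close> is the strictly lowest vertex of \<open>M\<close> for
    \<open>a\<close>, so an ascent for \<open>- a\<close> inside \<open>M\<close> must end there.
    The level used for that ascent only has to lie below its start \<open>u'\<close>.\<close>
  obtain a b where ab: "a \<bullet> v' < b" "\<And>w. w extreme_point_of M \<Longrightarrow> w \<noteq> v' \<Longrightarrow> b < a \<bullet> w"
    by (rule polytope_vertex_separation[OF pM ext(2)]) auto
  obtain z where z: "z extreme_point_of M" "\<forall>x\<in>M. - a \<bullet> x \<le> - a \<bullet> z"
      "(u', z) \<in> (edges_above M (- a) (- a \<bullet> u' - 1))\<^sup>*"
    using polytope_path_to_maximum[OF pM ext(1), of "- a \<bullet> u' - 1" "- a"] by auto
  have "v' \<in> M" using ext by (simp add: extreme_point_of_def)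
  then have "z = v'" using ab z by fastforce
  \<comment> \<open>\<open>c\<close> is constant on \<open>M\<close> with a value above
    \<open>s\<close>, so every path inside \<open>M\<close> stays above \<open>s\<close>.\<close>
  have "edges_above M (- a) (- a \<bullet> u' - 1) \<subseteq> edges_above P c s"
  proof
    fix e assume "e \<in> edges_above M (- a) (- a \<bullet> u' - 1)"
    then obtain x y where e: "e = (x, y)" "closed_segment x y edge_of M"
      by (auto simp: edges_above_def)
    then have "closed_segment x y edge_of P"
      using M face_of_trans by (auto simp: edge_of_def)
    moreover have "x \<in> M" "y \<in> M" using edge_of_endpoints[OF e(2)] by auto
    moreover have "s < c \<bullet> u'" using u u' uvP by force
    ultimately show "e \<in> edges_above P c s" using e by (auto simp: edges_above_def M_def)
  qed
  then have "(u', v') \<in> ?R" using z \<open>z = v'\<close> rtrancl_mono by blast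
  moreover have "(v', v) \<in> ?R"
    using v' sym_rtrancl[OF sym_edges_above] by (meson symD)
  ultimately show ?thesis using u' by (meson rtrancl_trans)
qed

text \<open>The hyperplane \<open>a \<bullet> x = b\<close> cuts off \<open>v\<close>, so the section \<open>?Q\<close> is the vertex figure of \<open>v\<close>: its
  vertices lie on the edges of \<open>P\<close> at \<open>v\<close>, its edges in the 2-faces at \<open>v\<close>.\<close>

lemma upward_edges_connected:
  fixes P :: "'a::euclidean_space set"
  assumes P: "polytope P" and v: "v extreme_point_of P"
    and x: "closed_segment v x edge_of P" "c \<bullet> v < c \<bullet> x"
    and y: "closed_segment v y edge_of P" "c \<bullet> v < c \<bullet> y"
  defines "R \<equiv> {(x, y). c \<bullet> v < c \<bullet> x \<and> c \<bullet> v < c \<bullet> y \<and>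
     (\<exists>F. F face_of P \<and> aff_dim F = 2 \<and> closed_segment v x edge_of F \<and> closed_segment v y edge_of F)}"
  shows "(x, y) \<in> R\<^sup>*"
proof -
  obtain a b where av: "a \<bullet> v < b" and sep: "\<And>u. u extreme_point_of P \<Longrightarrow> u \<noteq> v \<Longrightarrow> b < a \<bullet> u"
    by (rule polytope_vertex_separation[OF P v]) auto
  have nv: "a \<bullet> u \<noteq> b" if "u extreme_point_of P" for u
    using sep[OF that] av by (cases "u = v") auto
  let ?H = "{x. a \<bullet> x = b}"
  let ?Q = "P \<inter> ?H"
  have Q: "polytope ?Q" using polytope_Int_hyperplane[OF P] .
  have sep': "b < a \<bullet> u" if "closed_segment v u edge_of P" for u
    using edge_of_endpoints[OF that] sep by auto
  obtain p where p: "p \<in> open_segment v x" "p extreme_point_of ?Q"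
    using edge_of_Int_hyperplane[OF x(1) av sep'[OF x(1)]] .
  obtain q where q: "q \<in> open_segment v y" "q extreme_point_of ?Q"
    using edge_of_Int_hyperplane[OF y(1) av sep'[OF y(1)]] .
  have Hq: "b = a \<bullet> r" if "r extreme_point_of ?Q" for r
    using that by (simp add: extreme_point_of_def)
  \<comment> \<open>The face property forces \<open>w\<close> into the first edge, whose only
    extreme points are its two ends.\<close>
  have unique: "u = w"
    if "r \<in> open_segment v u" "r \<in> open_segment v w" "closed_segment v u edge_of P"
      "closed_segment v w edge_of P" for r u w
  proof -
    have "closed_segment v u face_of P" using that by (simp add: edge_of_def)
    moreover have "r \<in> closed_segment v u" using that by (simp add: open_segment_def)
    moreover have "w \<in> P" "v \<in> P" using edge_of_endpoints that by blast+
    ultimately have "w \<in> closed_segment v u" using that(2) face_ofD by blast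
    moreover have "w extreme_point_of P" "w \<noteq> v" using edge_of_endpoints that by blast+
    ultimately show ?thesis
      using extreme_point_of_face[of "closed_segment v u" P w] \<open>closed_segment v u face_of P\<close>
      by (auto simp: extreme_point_of_segment)
  qed
  have "(p, q) \<in> (edges_above ?Q c (c \<bullet> v))\<^sup>*"
    using edges_above_connected[OF Q p(2) _ q(2)] inner_open_segment_gt_iff p(1) q(1) x y by blast
  \<comment> \<open>Each node of the path in \<open>?Q\<close> is replaced by the far end of the
    edge of \<open>P\<close> through it; quantifying over all such ends avoids choosing one.\<close>
  then have "\<forall>y. q \<in> open_segment v y \<longrightarrow> closed_segment v y edge_of P \<longrightarrow> (x, y) \<in> R\<^sup>*"
  proof (induction rule: rtrancl_induct)
    case base
    then show ?case using unique p x by blast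
  next
    case (step q r)
    have e: "closed_segment q r edge_of ?Q" "c \<bullet> v < c \<bullet> q" "c \<bullet> v < c \<bullet> r"
      using step.hyps by (auto simp: edges_above_def)
    note qr = edge_of_endpoints[OF e(1)]
    obtain u where u: "closed_segment v u edge_of P" "q \<in> open_segment v u"
      using vertex_figure_vertex[OF P av sep qr(1)] .
    show ?case
    proof (intro allI impI)
      fix w assume w: "r \<in> open_segment v w" "closed_segment v w edge_of P"
      \<comment> \<open>The edge of the vertex figure extends to a 2-face of \<open>P\<close>, which
        will contain both edges at \<open>v\<close> through \<open>q\<close> and
        \<open>r\<close>.\<close>
      obtain F where F: "F face_of P" "closed_segment q r = F \<inter> ?H"
          "aff_dim F = aff_dim (closed_segment q r) + 1"
        using face_of_hyperplane_section[OF P _ _ nv, of "closed_segment q r"] e(1)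
        by (auto simp: edge_of_def)
      have "aff_dim F = 2" using F e by (simp add: edge_of_def)
      have "q \<in> F" "r \<in> F" using F by auto
      have in_F: "closed_segment v u edge_of F"
        if "q \<in> F" "q \<in> open_segment v u" "closed_segment v u edge_of P" for q u
      proof -
        have "v \<in> F" "u \<in> F" using face_ofD[OF F(1) that(2)] edge_of_endpoints[OF that(3)] that by auto
        then have "closed_segment v u \<subseteq> F"
          using F face_of_imp_convex closed_segment_subset by blast
        then show ?thesis using that face_of_face[OF F(1)] by (auto simp: edge_of_def)
      qed
      have "(u, w) \<in> R"
        unfolding R_def using F \<open>aff_dim F = 2\<close> in_F[OF \<open>q \<in> F\<close> u(2,1)] in_F[OF \<open>r \<in> F\<close> w]
          inner_open_segment_gt_iff[OF u(2), of c] inner_open_segment_gt_iff[OF w(1), of c] e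
        by blast
      then show "(x, w) \<in> R\<^sup>*" using step.IH u by (meson rtrancl_into_rtrancl)
    qed
  qed
  then show ?thesis using q y by blast
qed

section \<open>Generic functionals and the gluing of edge potentials\<close>

text \<open>It suffices not to vanish on the finitely many nonzero differences; these are treated
  one at a time, by a generic perturbation of the functional.\<close>

lemma exists_inner_inj_on:
  fixes S :: "'a::euclidean_space set"
  assumes "finite S"
  obtains c where "inj_on (\<lambda>x. c \<bullet> x) S"
proof -
  have nonzero: "\<exists>c. \<forall>x\<in>D. c \<bullet> x \<noteq> 0" if "finite D" "0 \<notin> D" for D :: "'a set"
    using that
  proof (induction D rule: finite_induct)
    case (insert x D)
    then obtain c where c: "\<forall>y\<in>D. c \<bullet> y \<noteq> 0" by auto
    \<comment> \<open>Contains every \<open>t\<close> at which the perturbed functional vanishes on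
      some \<open>y\<close> with \<open>x \<bullet> y\<close> nonzero. If
      \<open>x \<bullet> y = 0\<close>, then \<open>y\<close> is in \<open>D\<close> and its value
      under \<open>c\<close> is unchanged.\<close>
    let ?bad = "(\<lambda>y. - (c \<bullet> y) / (x \<bullet> y)) ` insert x D"
    obtain t where t: "t \<notin> ?bad" "t \<noteq> 0"
      using ex_new_if_finite[of "insert 0 ?bad"] insert.hyps by (auto simp: infinite_UNIV_char_0)
    have "(c + t *\<^sub>R x) \<bullet> y \<noteq> 0" if "y \<in> insert x D" for y
    proof
      assume "(c + t *\<^sub>R x) \<bullet> y = 0"
      then have eq: "c \<bullet> y + t * (x \<bullet> y) = 0" by (simp add: inner_simps)
      show False
      proof (cases "x \<bullet> y = 0")
        case True
        then have "y \<noteq> x" using insert.prems by auto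
        then show False using True eq c that by auto
      next
        case False
        then have "t = - (c \<bullet> y) / (x \<bullet> y)" using eq by (simp add: field_simps)
        then show False using t that by blast
      qed
    qed
    then show ?case by blast
  qed simp
  have "finite ((\<lambda>(x, y). x - y) ` (S \<times> S) - {0})" using assms by simp
  from nonzero[OF this] obtain c where "\<forall>z \<in> (\<lambda>(x, y). x - y) ` (S \<times> S) - {0}. c \<bullet> z \<noteq> 0"
    by auto
  then have "x - y = 0" if "x \<in> S" "y \<in> S" "c \<bullet> x = c \<bullet> y" for x y
    using that by (force simp: inner_diff_right)
  then have "inj_on (\<lambda>x. c \<bullet> x) S" by (simp add: inj_on_def)
  then show thesis by (rule that)
qed

text \<open>In cohomological terms \<open>w\<close> is a 1-cochain that is exact around every
  2-face, and the claim is that the first cohomology of the 2-skeleton vanishes. The sweep along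
  \<open>c\<close> proves this directly.\<close>

lemma polytope_potential_local_to_global:
  fixes P :: "'a::euclidean_space set" and w :: "'a \<Rightarrow> 'a \<Rightarrow> 'b::ab_group_add"
  assumes P: "polytope P"
    and antisym: "\<And>u v. closed_segment u v edge_of P \<Longrightarrow> w v u = - w u v"
    and local: "\<And>F. F face_of P \<Longrightarrow> aff_dim F = 2 \<Longrightarrow>
      \<exists>f. \<forall>u v. closed_segment u v edge_of F \<longrightarrow> f v - f u = w u v"
  shows "\<exists>f. \<forall>u v. closed_segment u v edge_of P \<longrightarrow> f v - f u = w u v"
proof -
  let ?V = "{v. v extreme_point_of P}"
  have fin: "finite ?V" using P by (simp add: finite_polyhedron_extreme_points polytope_imp_polyhedron)
  then obtain c where c: "inj_on (\<lambda>x. c \<bullet> x) ?V" using exists_inner_inj_on by blast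
  \<comment> \<open>Induction over vertex sets \<open>A\<close> that are closed upwards with respect
    to \<open>c\<close>; the final instance is \<open>A = ?V\<close>.\<close>
  have "\<exists>f. \<forall>u\<in>A. \<forall>v\<in>A. closed_segment u v edge_of P \<longrightarrow> f v - f u = w u v"
    if "A \<subseteq> ?V" "\<And>u v. u \<in> A \<Longrightarrow> v \<in> ?V \<Longrightarrow> c \<bullet> u < c \<bullet> v \<Longrightarrow> v \<in> A" for A
    using finite_subset[OF that(1) fin] that
  proof (induction A rule: finite_psubset_induct)
    case (psubset A)
    show ?case
    proof (cases "A = {}")
      case False
      \<comment> \<open>Removing the lowest vertex keeps the set closed upwards; by injectivity of
        \<open>c\<close>, what remains is exactly the set of vertices strictly above
        \<open>v\<close>.\<close>
      define v where "v = arg_min_on (\<lambda>x. c \<bullet> x) A"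
      have vA: "v \<in> A" and vmin: "\<And>u. u \<in> A \<Longrightarrow> c \<bullet> v \<le> c \<bullet> u"
        using arg_min_if_finite[OF psubset.hyps(1) False, of "\<lambda>x. c \<bullet> x"]
        unfolding v_def by (auto simp: not_less)
      have vV: "v extreme_point_of P" using vA psubset.prems by auto
      have above: "u \<in> A - {v} \<longleftrightarrow> u extreme_point_of P \<and> c \<bullet> v < c \<bullet> u" for u
      proof
        assume u: "u \<in> A - {v}"
        then have "u extreme_point_of P" using psubset.prems by auto
        moreover have "c \<bullet> v \<noteq> c \<bullet> u" using c u vV calculation by (auto dest: inj_onD)
        ultimately show "u extreme_point_of P \<and> c \<bullet> v < c \<bullet> u" using vmin[of u] u by auto
      next
        assume "u extreme_point_of P \<and> c \<bullet> v < c \<bullet> u"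
        then show "u \<in> A - {v}" using psubset.prems(2)[OF vA] by auto
      qed
      have "\<exists>f. \<forall>u\<in>A - {v}. \<forall>x\<in>A - {v}. closed_segment u x edge_of P \<longrightarrow> f x - f u = w u x"
      proof (rule psubset.IH)
        show "A - {v} \<subset> A" using vA by blast
        show "A - {v} \<subseteq> ?V" using psubset.prems by blast
        show "y \<in> A - {v}" if "u \<in> A - {v}" "y \<in> ?V" "c \<bullet> u < c \<bullet> y" for u y
          using that above[of u] above[of y] by auto
      qed
      then obtain f where f: "\<And>u x. u \<in> A - {v} \<Longrightarrow> x \<in> A - {v} \<Longrightarrow>
          closed_segment u x edge_of P \<Longrightarrow> f x - f u = w u x"
        by blast
      \<comment> \<open>Above \<open>v\<close>, \<open>f\<close> and the local potential
        \<open>g\<close> of \<open>F\<close> have equal increments along edges, so by connectedness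
        they differ by a constant there.\<close>
      have local_step: "f x - w v x = f y - w v y"
        if F: "F face_of P" "aff_dim F = 2" and x: "closed_segment v x edge_of F" "c \<bullet> v < c \<bullet> x"
          and y: "closed_segment v y edge_of F" "c \<bullet> v < c \<bullet> y" for F x y
      proof -
        obtain g where g: "\<And>u z. closed_segment u z edge_of F \<Longrightarrow> g z - g u = w u z"
          using local[OF F] by blast
        have "polytope F" using P F face_of_polytope_polytope by blast
        then have "(x, y) \<in> (edges_above F c (c \<bullet> v))\<^sup>*"
          using edges_above_connected edge_of_endpoints(2) x y by blast
        then have "f y - g y = f x - g x"
        proof (induction rule: rtrancl_induct)
          case (step u z)
          then have e: "closed_segment u z edge_of F" "c \<bullet> v < c \<bullet> u" "c \<bullet> v < c \<bullet> z"
            by (auto simp: edges_above_def)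
          then have eP: "closed_segment u z edge_of P"
            using F face_of_trans by (auto simp: edge_of_def)
          have "u \<in> A - {v}" "z \<in> A - {v}" using above edge_of_endpoints[OF eP] e by auto
          then have "f z - f u = g z - g u" using f eP g e by simp
          then have "f z - g z = f u - g u" by (simp add: algebra_simps)
          then show ?case using step.IH by simp
        qed simp
        then have "f y - (g y - g v) = f x - (g x - g v)" by (simp add: diff_diff_eq2 diff_add_eq[symmetric])
        then show ?thesis using g x y by simp
      qed
      have const: "f x - w v x = f y - w v y"
        if x: "closed_segment v x edge_of P" "c \<bullet> v < c \<bullet> x"
          and y: "closed_segment v y edge_of P" "c \<bullet> v < c \<bullet> y" for x y
        using upward_edges_connected[OF P vV x y]
      proof (induction rule: rtrancl_induct)
        case (step y z)
        then obtain F where "F face_of P" "aff_dim F = 2" "closed_segment v y edge_of F"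
            "c \<bullet> v < c \<bullet> y" "closed_segment v z edge_of F" "c \<bullet> v < c \<bullet> z"
          by auto
        then have "f y - w v y = f z - w v z" by (rule local_step)
        then show ?case using step.IH by simp
      qed simp
      \<comment> \<open>The value that all upward edges prescribe at \<open>v\<close>; if there is
        no upward edge, any \<open>k\<close> will do.\<close>
      obtain k where k: "f x - w v x = k" if "closed_segment v x edge_of P" "c \<bullet> v < c \<bullet> x" for x
        using const by metis
      define f' where "f' = f(v := k)"
      have up: "f' x - f' v = w v x" if "closed_segment v x edge_of P" "x \<in> A" for x
      proof -
        have "x \<noteq> v" using edge_of_endpoints that by blast
        then have "c \<bullet> v < c \<bullet> x" using above that by blast
        then show ?thesis using k[of x] that \<open>x \<noteq> v\<close> by (auto simp: f'_def algebra_simps)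
      qed
      have "f' x - f' u = w u x" if ux: "u \<in> A" "x \<in> A" "closed_segment u x edge_of P" for u x
      proof -
        consider "u = v" | "x = v" | "u \<noteq> v" "x \<noteq> v" by blast
        then show ?thesis
        proof cases
          case 1 then show ?thesis using up ux by blast
        next
          case 2
          then have e: "closed_segment v u edge_of P" using ux by (simp add: closed_segment_commute)
          then show ?thesis using up[OF e] ux antisym[OF e] 2 by (metis minus_diff_eq)
        next
          case 3 then show ?thesis using f ux by (simp add: f'_def)
        qed
      qed
      then show ?thesis by blast
    qed simp
  qed
  from this[of ?V] show ?thesis using edge_of_endpoints(1,2) by blast
qed

section \<open>Edges in 2-faces and injectivity of linear maps\<close>

text \<open>Above dimension 2 an edge is a proper face and so lies in a facet; the descent through
  facets stops at dimension 2.\<close>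

lemma edge_of_subset_2_face:
  fixes P :: "'a::euclidean_space set"
  assumes "polytope P" "E edge_of P" "2 \<le> aff_dim P"
  obtains F where "F face_of P" "aff_dim F = 2" "E \<subseteq> F"
proof -
  have "\<exists>F. F face_of P \<and> aff_dim F = 2 \<and> E \<subseteq> F"
    using assms
  proof (induction "nat (aff_dim P)" arbitrary: P rule: less_induct)
    case less
    show ?case
    proof (cases "aff_dim P = 2")
      case True
      then show ?thesis
        using less.prems by (intro exI[of _ P]) (simp add: face_of_refl polytope_imp_convex edge_of_imp_subset)
    next
      case False
      have E: "E face_of P" "aff_dim E = 1" using less.prems by (auto simp: edge_of_def)
      then have "E \<noteq> {}" "E \<noteq> P" using less.prems by auto
      then obtain G where G: "G facet_of P" "E \<subseteq> G"
        using face_of_polyhedron_subset_facet[OF polytope_imp_polyhedron[OF less.prems(1)] E(1)] by blast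
      then have GP: "G face_of P" "aff_dim G = aff_dim P - 1" by (auto simp: facet_of_def)
      have "E edge_of G" using E G face_of_face[OF GP(1)] by (simp add: edge_of_def)
      moreover have "polytope G" using less.prems GP face_of_polytope_polytope by blast
      moreover have "nat (aff_dim G) < nat (aff_dim P)" "2 \<le> aff_dim G"
        using GP False less.prems(3) by auto
      ultimately obtain F where "F face_of G" "aff_dim F = 2" "E \<subseteq> F"
        using less.hyps[of G] by auto
      then show ?thesis using GP face_of_trans by blast
    qed
  qed
  then show thesis using that by blast
qed

text \<open>Injectivity on \<open>S\<close> passes to the direction space of its affine hull because a relative
  interior point of \<open>S\<close> can be moved a little in every such direction.\<close>

lemma linear_inj_on_convex_left_inverse:
  fixes L :: "'a::euclidean_space \<Rightarrow> 'b::euclidean_space"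
  assumes L: "linear L" and S: "convex S" and inj: "inj_on L S"
  obtains g where "linear g" "\<And>x y. x \<in> S \<Longrightarrow> y \<in> S \<Longrightarrow> g (L (x - y)) = x - y"
proof (cases "S = {}")
  case True
  then show thesis using that[of "\<lambda>_. 0"] by (simp add: linear_zero)
next
  case False
  then obtain p where p: "p \<in> rel_interior S" using rel_interior_eq_empty S by blast
  then obtain e where e: "0 < e" "ball p e \<inter> affine hull S \<subseteq> S" "p \<in> S"
    by (auto simp: mem_rel_interior_ball)
  let ?D = "(\<lambda>x. - p + x) ` S"
  have zero: "z = 0" if z: "z \<in> span ?D" "L z = 0" for z
  proof (rule ccontr)
    assume nz: "z \<noteq> 0"
    \<comment> \<open>With this \<open>t\<close> the displacement has norm \<open>e / 2\<close>, so
      the moved point stays in the open ball.\<close>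
    define t where "t = e / (2 * norm z)"
    have t: "0 < t" using nz e by (simp add: t_def)
    have "t *\<^sub>R z \<in> span ?D" using z by (simp add: span_mul)
    then have "p + t *\<^sub>R z \<in> affine hull S" using affine_hull_span_gen[OF hull_inc[OF e(3)]] by auto
    moreover have "p + t *\<^sub>R z \<in> ball p e" using nz e by (simp add: dist_norm t_def)
    ultimately have "p + t *\<^sub>R z \<in> S" using e by blast
    moreover have "L (p + t *\<^sub>R z) = L p" using z L by (simp add: linear_add linear_cmul)
    ultimately have "p + t *\<^sub>R z = p" using inj e(3) by (meson inj_onD)
    then show False using t nz by simp
  qed
  have "inj_on L (span ?D)"
    by (rule inj_onI) (metis L zero linear_diff right_minus_eq span_diff)
  then obtain g where g: "linear g" "\<forall>x \<in> span ?D. g (L x) = x"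
    using linear_inj_on_left_inverse[OF L] by blast
  have "x - y \<in> span ?D" if "x \<in> S" "y \<in> S" for x y
  proof -
    have "(- p + x) - (- p + y) \<in> span ?D" using that by (intro span_diff span_base) auto
    then show ?thesis by simp
  qed
  then show thesis using g that by blast
qed

section \<open>Edge factors of deformations and comparison of the cones\<close>

lemma deformation_edge_deformation_vector:
  assumes def: "deformation F G" and e: "{u, v} \<in> fedges F" and ne: "fpos F u \<noteq> fpos F v"
  shows "0 \<le> edge_deformation_vector F G {u, v}"
    "fpos G v - fpos G u = edge_deformation_vector F G {u, v} *\<^sub>R (fpos F v - fpos F u)"
proof -
  obtain c where "c \<ge> 0" "fpos G v - fpos G u = c *\<^sub>R (fpos F v - fpos F u)"
    using def e unfolding deformation_def by blast
  then show "0 \<le> edge_deformation_vector F G {u, v}"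
    "fpos G v - fpos G u = edge_deformation_vector F G {u, v} *\<^sub>R (fpos F v - fpos F u)"
    using edge_deformation_vector_eqI[OF e ne] by auto
qed

text \<open>A transfer criterion for both inclusions. Nondegeneracy excludes the default value 0, so
  the equation for \<open>G'\<close> determines every coordinate; off the edge set both vectors are
  \<open>undefined\<close>.\<close>

lemma edge_deformation_vector_cong:
  assumes G: "deformation F G" and edges: "fedges F' = fedges F" "is_framework F"
    and nd: "\<And>u v. {u, v} \<in> fedges F \<Longrightarrow> fpos F u \<noteq> fpos F v \<and> fpos F' u \<noteq> fpos F' v"
    and eq: "\<And>u v. {u, v} \<in> fedges F \<Longrightarrow>
      fpos G' v - fpos G' u = edge_deformation_vector F G {u, v} *\<^sub>R (fpos F' v - fpos F' u)"
  shows "edge_deformation_vector F' G' = edge_deformation_vector F G"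
proof
  fix e
  show "edge_deformation_vector F' G' e = edge_deformation_vector F G e"
  proof (cases "e \<in> fedges F")
    case True
    then obtain u v where "e = {u, v}"
      using edges(2) by (auto simp: is_framework_def card_2_iff)
    then show ?thesis using edge_deformation_vector_eqI[of u v F'] nd eq True edges by auto
  next
    case False
    then show ?thesis by (simp add: edge_deformation_vector_def edges)
  qed
qed

lemma polytope_framework_edge_iff:
  fixes P :: "'a::euclidean_space set"
  shows "{u, v} \<in> fedges (polytope_framework P) \<longleftrightarrow> closed_segment u v edge_of P"
  by (auto simp: polytope_framework_def doubleton_eq_iff closed_segment_commute)

theorem corollary2p4p9:
  fixes P :: "'a::euclidean_space set"
    and h :: "'a \<Rightarrow> 'b::euclidean_space"
  assumes "polytope P"
    and "affine_map h"
    and "\<And>S. S face_of P \<Longrightarrow> aff_dim S = 2 \<Longrightarrow> inj_on h S"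
    (* without this, a segment collapsed by h is a counterexample; it is vacuous unless dim P = 1 *)
    and "aff_dim P = 1 \<Longrightarrow> inj_on h P"
  shows "deformation_cone (polytope_framework P)
           = deformation_cone (map_framework h (polytope_framework P))
       \<and> edge_dependency_graph (polytope_framework P)
           = edge_dependency_graph (map_framework h (polytope_framework P))"
proof -
  let ?F = "polytope_framework P" and ?F' = "map_framework h (polytope_framework P)"
  have F: "is_framework ?F" using assms(1) by (rule is_framework_polytope_framework)
  then have F': "is_framework ?F'" by (simp add: is_framework_def map_framework_def)
  have pos: "fpos ?F = id" "fpos ?F' = h" by (simp_all add: polytope_framework_def map_framework_def)
  have edges: "fedges ?F' = fedges ?F" "fverts ?F' = fverts ?F" by (simp_all add: map_framework_def)
  obtain L c where L: "linear L" "h = (\<lambda>x. L x + c)" using assms(2) by (auto simp: affine_map_def)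
  then have h_diff: "h x - h y = L (x - y)" for x y by (simp add: linear_diff)
  \<comment> \<open>Every edge lies in a set on which \<open>h\<close> is injective:
    \<open>P\<close> itself in dimension 1, a 2-face in higher dimension. Hence the image has no
    degenerate edges.\<close>
  have inj_edge: "h u \<noteq> h v" if e: "closed_segment u v edge_of P" for u v
  proof -
    have "aff_dim (closed_segment u v) \<le> aff_dim P"
      using e by (intro aff_dim_subset) (simp add: edge_of_imp_subset)
    then have "1 \<le> aff_dim P" using e by (simp add: edge_of_def)
    then consider "aff_dim P = 1" | "2 \<le> aff_dim P" by linarith
    then obtain S where "inj_on h S" "u \<in> S" "v \<in> S"
    proof cases
      case 1
      then show thesis using that assms(4) edge_of_endpoints[OF e] by blast
    next
      case 2
      then obtain S where "S face_of P" "aff_dim S = 2" "closed_segment u v \<subseteq> S"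
        using edge_of_subset_2_face[OF assms(1) e] by blast
      then show thesis using that assms(3) by (meson ends_in_segment subsetD)
    qed
    then show ?thesis using edge_of_endpoints(3)[OF e] by (auto dest: inj_onD)
  qed
  have nd: "fpos ?F u \<noteq> fpos ?F v \<and> fpos ?F' u \<noteq> fpos ?F' v" if "{u, v} \<in> fedges ?F" for u v
    using that edge_of_endpoints(3) inj_edge by (auto simp: pos polytope_framework_edge_iff)
  have "deformation_cone ?F \<subseteq> deformation_cone ?F'"
  proof
    fix l assume "l \<in> deformation_cone ?F"
    then obtain G where G: "deformation ?F G" and l: "l = edge_deformation_vector ?F G"
      by (auto simp: deformation_cone_def)
    \<comment> \<open>Only differences of positions matter, so the linear part of \<open>h\<close>
      is enough.\<close>
    define G' where "G' = map_framework L G"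
    have G'_simps: "fverts G' = fverts G" "fedges G' = fedges G" "fpos G' = L \<circ> fpos G"
      by (simp_all add: G'_def map_framework_def)
    have nonneg: "0 \<le> l {u, v}" and
      eq: "fpos G' v - fpos G' u = l {u, v} *\<^sub>R (fpos ?F' v - fpos ?F' u)"
      if e: "{u, v} \<in> fedges ?F" for u v
    proof -
      have ne: "fpos ?F u \<noteq> fpos ?F v" using nd[OF e] by blast
      show "0 \<le> l {u, v}"
        unfolding l by (rule deformation_edge_deformation_vector(1)[OF G e ne])
      have "L (fpos G v - fpos G u) = L (l {u, v} *\<^sub>R (v - u))"
        using deformation_edge_deformation_vector(2)[OF G e ne] by (simp add: l pos)
      then show "fpos G' v - fpos G' u = l {u, v} *\<^sub>R (fpos ?F' v - fpos ?F' u)"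
        by (simp add: G'_simps pos(2) h_diff linear_diff[OF L(1)] linear_cmul[OF L(1)])
    qed
    have "is_framework G'" "fverts G' = fverts ?F'" "fedges G' = fedges ?F'"
      using G by (auto simp: deformation_def is_framework_def G'_simps edges)
    then have "deformation ?F' G'"
      using eq nonneg unfolding deformation_def edges by blast
    moreover have "edge_deformation_vector ?F' G' = l"
      unfolding l
      by (rule edge_deformation_vector_cong[OF G edges(1) F]) (use nd eq[unfolded l] in blast)+
    ultimately show "l \<in> deformation_cone ?F'" by (auto simp: deformation_cone_def)
  qed
  moreover have "deformation_cone ?F' \<subseteq> deformation_cone ?F"
  proof
    fix l assume "l \<in> deformation_cone ?F'"
    then obtain G where G: "deformation ?F' G" and l: "l = edge_deformation_vector ?F' G"
      by (auto simp: deformation_cone_def)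
    have lG: "0 \<le> l {u, v}" "fpos G v - fpos G u = l {u, v} *\<^sub>R L (v - u)"
      if "closed_segment u v edge_of P" for u v
      using deformation_edge_deformation_vector[OF G, of u v] nd[of u v] that
      by (auto simp: edges polytope_framework_edge_iff l pos h_diff)
    have "\<exists>f. \<forall>u v. closed_segment u v edge_of P \<longrightarrow> f v - f u = l {u, v} *\<^sub>R (v - u)"
    proof (rule polytope_potential_local_to_global[OF assms(1)])
      show "l {v, u} *\<^sub>R (u - v) = - (l {u, v} *\<^sub>R (v - u))" for u v
        by (simp add: insert_commute flip: scaleR_minus_right)
    next
      fix S assume S: "S face_of P" "aff_dim S = 2"
      have "inj_on L S" using assms(3)[OF S] by (simp add: L(2) inj_on_def)
      \<comment> \<open>\<open>g\<close> depends on \<open>S\<close>, so the positions recovered on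
        different 2-faces need not agree; only their increments along common edges do.\<close>
      then obtain g where g: "linear g" "\<And>x y. x \<in> S \<Longrightarrow> y \<in> S \<Longrightarrow> g (L (x - y)) = x - y"
        using linear_inj_on_convex_left_inverse[OF L(1) face_of_imp_convex[OF S(1)]] by blast
      have "g (fpos G v) - g (fpos G u) = l {u, v} *\<^sub>R (v - u)"
        if e: "closed_segment u v edge_of S" for u v
      proof -
        have "closed_segment u v edge_of P" using e S face_of_trans by (auto simp: edge_of_def)
        then have "g (fpos G v) - g (fpos G u) = l {u, v} *\<^sub>R g (L (v - u))"
          using lG g(1) by (metis linear_diff linear_cmul)
        then show ?thesis using g(2) edge_of_endpoints[OF e] by simp
      qed
      then show "\<exists>f. \<forall>u v. closed_segment u v edge_of S \<longrightarrow> f v - f u = l {u, v} *\<^sub>R (v - u)"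
        by (intro exI[of _ "g \<circ> fpos G"]) auto
    qed
    then obtain f where f: "\<And>u v. closed_segment u v edge_of P \<Longrightarrow> f v - f u = l {u, v} *\<^sub>R (v - u)"
      by blast
    \<comment> \<open>The glued potential \<open>f\<close> supplies the vertex positions in the
      original space.\<close>
    define G' where "G' = \<lparr>fverts = fverts ?F, fedges = fedges ?F, fpos = f\<rparr>"
    have "deformation ?F G'"
      using F by (auto simp: deformation_def is_framework_def G'_def polytope_framework_edge_iff pos f)
        (use lG(1) in blast)
    moreover have "edge_deformation_vector ?F G' = l"
      unfolding l
    proof (rule edge_deformation_vector_cong[OF G _ F'])
      show "fedges ?F = fedges ?F'" by (simp add: edges)
      show "fpos ?F' u \<noteq> fpos ?F' v \<and> fpos ?F u \<noteq> fpos ?F v" if "{u, v} \<in> fedges ?F'" for u v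
        using nd that by (auto simp: edges)
      show "fpos G' v - fpos G' u = edge_deformation_vector ?F' G {u, v} *\<^sub>R (fpos ?F v - fpos ?F u)"
        if "{u, v} \<in> fedges ?F'" for u v
        using that f by (simp add: edges polytope_framework_edge_iff G'_def pos l)
    qed
    ultimately show "l \<in> deformation_cone ?F" by (auto simp: deformation_cone_def)
  qed
  ultimately have cone: "deformation_cone ?F = deformation_cone ?F'" by blast
  \<comment> \<open>All edges are nodes of both dependency graphs, so equality of the cones carries
    over to the graphs.\<close>
  have "\<not> degenerate ?F e \<and> \<not> degenerate ?F' e" if "e \<in> fedges ?F" for e
    using that nd unfolding degenerate_def by metis
  then have "{e \<in> fedges ?F. \<not> degenerate ?F e} = {e \<in> fedges ?F'. \<not> degenerate ?F' e}"
    by (auto simp: edges)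
  then show ?thesis using cone by (simp add: edge_dependency_graph_def)
qed

end
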